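(* Let $Q\ge 0$ be an integer, let $\sigma_0,\dots,\sigma_Q>0$, and let $\lambda=(\lambda_0,\dots,\lambda_Q)$ with $\lambda_q\ge 0$ and $\sum_{q=0}^{Q}\lambda_q=1$. Let $k_\lambda=\sum_{q=0}^Q\lambda_q k_{H_q}$ be the convex combination of sliced Wasserstein kernels with bandwidths $\sigma_0,\dots,\sigma_Q$, and let $d_{k_\lambda}$ be the RKHS metric it induces. Let $N\ge 1$ be an integer and let $D_n,D_m\in\mathcal{D}_b^f(Q)$ be such that for every $q\in\{0,\dots,Q\}$ each of $D_n^{(q)}$, $D_m^{(q)}$ has at most $N$ points (counted with multiplicity). For each $q$, let $T_q>0$ be such that $\mathrm{SW}\big(D_n^{(q)},D_m^{(q)}\big)/(2\sigma_q^2)\le T_q$. Put $M=1+2N(2N-1)$ and $$\kappa_q=\frac{1-e^{-T_q}}{2\sigma_q^2\,T_q\,M}>0 .$$ Then $$d_{k_\lambda}^2(D_n,D_m)\ \ge\ \Bigl(\min_{0\le q\le Q}\kappa_q\Bigr)\sum_{q=0}^{Q}\lambda_q\,d_1^{(q)}\big(D_n^{(q)},D_m^{(q)}\big).$$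
   Context: **Diagrams.** Let $\Delta=\{(x,x): x>0\}$ be the diagonal and let $\pi_\Delta$ denote orthogonal projection onto the diagonal, $\pi_\Delta(x,y)=(\frac{x+y}{2},\frac{x+y}{2})$. A persistence diagram is a multiset of points of $\{(x,y): x>0,\,y>0\}\setminus\Delta$; it is finite and bounded if it has finitely many points (with multiplicity) contained in a bounded set. $\mathcal{D}_b^f(Q)$ is the set of finite bounded persistence diagrams $D$ whose points are graded by homology dimension and which have no points in dimension larger than $Q$; thus $D$ is given by its restrictions $D^{(0)},\dots,D^{(Q)}$, where $D^{(q)}$ is the (possibly empty) finite bounded persistence diagram formed by the points of $D$ coming from the $q$-th homology group. **Diagram distance.** For finite bounded diagrams $D_1,D_2$, a partial matching is a bijection $\gamma:A\to B$ between sub-multisets $A\subseteq D_1$, $B\subseteq D_2$. Its cost is $c(\gamma)=\sum_{x\in A}\|x-\gamma(x)\|_\infty+\sum_{y}\|y-\pi_\Delta(y)\|_\infty$, where the second sum runs over the unmatched points, i.e. those of $D_1\setminus A$ and $D_2\setminus B$ (with multiplicity). Put $d_1(D_1,D_2)=\inf_\gamma c(\gamma)$. Write $d_1^{(q)}$ for $d_1$ applied to the dimension-$q$ diagrams. **Sliced Wasserstein distance.** For an angle $\theta$, let $\pi_\theta:\mathbb{R}^2\to\mathbb{R}$, $\pi_\theta(p)=\langle p,(\cos\theta,\sin\theta)\rangle$. For finite bounded diagrams $D_1,D_2$ set $\mu_i^\theta=\sum_{p\in D_i}\delta_{\pi_\theta(p)}$ and $\mu_{i\Delta}^\theta=\sum_{p\in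 D_i}\delta_{\pi_\theta(\pi_\Delta(p))}$ (with multiplicity), and $$\mathrm{SW}(D_1,D_2)=\frac1\pi\int_{-\pi/2}^{\pi/2}\mathcal{W}_1\big(\mu_1^\theta+\mu_{2\Delta}^\theta,\ \mu_2^\theta+\mu_{1\Delta}^\theta\big)\,d\theta,$$ where $\mathcal{W}_1$ is the $1$-Wasserstein distance (infimum over couplings of $\int|x-y|$, no normalization) between non-negative measures on $\mathbb{R}$ of equal total mass. **Kernels.** For $D,D'\in\mathcal{D}_b^f(Q)$, $k_{H_q}(D,D')=\exp\big(-\mathrm{SW}(D^{(q)},D'^{(q)})/(2\sigma_q^2)\big)$ and $k_\lambda(D,D')=\sum_{q=0}^Q\lambda_q k_{H_q}(D,D')$. **RKHS metric.** A positive definite kernel $k$ with feature map $\phi$ into its RKHS $\mathcal{H}_k$ induces $d_k(x,y)=\|\phi(x)-\phi(y)\|_{\mathcal{H}_k}$, equivalently $d_k^2(x,y)=k(x,x)-2k(x,y)+k(y,y)$. *)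

theory Defs
  imports "HOL-Probability.Probability"
begin

section \<open>Persistence diagrams\<close>

definition diagonal :: "(real \<times> real) set" where
  "diagonal = {(x, x) |x. x > 0}"

definition proj_diag :: "real \<times> real \<Rightarrow> real \<times> real" where
  "proj_diag p = ((fst p + snd p) / 2, (fst p + snd p) / 2)"

text \<open>The multisets of the library are finite, so finiteness and boundedness of a diagram are
  automatic.\<close>

type_synonym diagram = "(real \<times> real) multiset"

definition persistence_diagram :: "diagram \<Rightarrow> bool" where
  "persistence_diagram D \<longleftrightarrow> set_mset D \<subseteq> {(x, y). x > 0 \<and> y > 0} - diagonal"

text \<open>A graded diagram is the family of its restrictions to the homology dimensions.\<close>

type_synonym graded_diagram = "nat \<Rightarrow> diagram"

definition graded_diagrams :: "nat \<Rightarrow> graded_diagram set" where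
  "graded_diagrams Q = {D. (\<forall>q. persistence_diagram (D q)) \<and> (\<forall>q>Q. D q = {#})}"


section \<open>Diagram distance\<close>

text \<open>A bijection between sub-multisets \<open>A \<subseteq># D1\<close> and \<open>B \<subseteq># D2\<close> is encoded by its graph, a
  multiset of pairs whose first components form \<open>A\<close> and whose second components form \<open>B\<close>.\<close>

definition partial_matchings :: "diagram \<Rightarrow> diagram \<Rightarrow> ((real \<times> real) \<times> (real \<times> real)) multiset set" where
  "partial_matchings D1 D2 = {G. image_mset fst G \<subseteq># D1 \<and> image_mset snd G \<subseteq># D2}"

definition matching_cost ::
    "diagram \<Rightarrow> diagram \<Rightarrow> ((real \<times> real) \<times> (real \<times> real)) multiset \<Rightarrow> real" where
  "matching_cost D1 D2 G =
     (\<Sum>(x, y)\<in>#G. infnorm (x - y)) +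
     (\<Sum>y\<in>#(D1 - image_mset fst G) + (D2 - image_mset snd G). infnorm (y - proj_diag y))"

definition diagram_dist :: "diagram \<Rightarrow> diagram \<Rightarrow> real" where
  "diagram_dist D1 D2 = (INF G\<in>partial_matchings D1 D2. matching_cost D1 D2 G)"


section \<open>Sliced Wasserstein distance\<close>

text \<open>The sum of the Dirac measures at the points of \<open>M\<close>.  It turns unions of multisets into sums
  of measures.\<close>

definition dirac_sum :: "real multiset \<Rightarrow> real measure" where
  "dirac_sum M = measure_of UNIV (sets borel) (\<lambda>A. \<Sum>x\<in>#M. emeasure (return borel x) A)"

lemma space_dirac_sum [simp]: "space (dirac_sum M) = UNIV"
  by (simp add: dirac_sum_def space_measure_of_conv)

lemma sets_dirac_sum [simp]: "sets (dirac_sum M) = sets borel"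
  unfolding dirac_sum_def by (metis sets.sets_measure_of_eq space_borel)

lemma emeasure_dirac_sum:
  assumes A: "A \<in> sets borel"
  shows "emeasure (dirac_sum M) A = (\<Sum>x\<in>#M. emeasure (return borel x) A)"
proof (rule emeasure_measure_of[OF dirac_sum_def])
  show "countably_additive (sets (dirac_sum M)) (\<lambda>A. \<Sum>x\<in>#M. emeasure (return borel x) A)"
  proof (induction M)
    case empty
    show ?case by (auto simp: countably_additive_def)
  next
    case (add x M)
    show ?case
    proof (rule countably_additiveI)
      fix F :: "nat \<Rightarrow> real set"
      assume F: "range F \<subseteq> sets (dirac_sum (add_mset x M))" "disjoint_family F"
        "(\<Union>i. F i) \<in> sets (dirac_sum (add_mset x M))"
      have "(\<Sum>i. \<Sum>x\<in>#M. emeasure (return borel x) (F i)) =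
          (\<Sum>x\<in>#M. emeasure (return borel x) (\<Union>i. F i))"
        using add F by (auto simp: countably_additive_def)
      moreover have "(\<Sum>i. emeasure (return borel x) (F i)) = emeasure (return borel x) (\<Union>i. F i)"
        using F by (intro suminf_emeasure) auto
      ultimately show "(\<Sum>i. \<Sum>x\<in>#add_mset x M. emeasure (return borel x) (F i)) =
          (\<Sum>x\<in>#add_mset x M. emeasure (return borel x) (\<Union>i. F i))"
        by (simp add: suminf_add[symmetric])
    qed
  qed
qed (use A in \<open>auto simp: positive_def\<close>)

definition couplings :: "real measure \<Rightarrow> real measure \<Rightarrow> (real \<times> real) measure set" where
  "couplings \<mu> \<nu> = {\<gamma>. sets \<gamma> = sets (borel \<Otimes>\<^sub>M borel) \<and>
     distr \<gamma> borel fst = \<mu> \<and> distr \<gamma> borel snd = \<nu>}"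

definition wasserstein1 :: "real measure \<Rightarrow> real measure \<Rightarrow> ennreal" where
  "wasserstein1 \<mu> \<nu> = (INF \<gamma>\<in>couplings \<mu> \<nu>. \<integral>\<^sup>+ z. ennreal \<bar>fst z - snd z\<bar> \<partial>\<gamma>)"

definition proj_angle :: "real \<Rightarrow> real \<times> real \<Rightarrow> real" where
  "proj_angle \<theta> p = p \<bullet> (cos \<theta>, sin \<theta>)"

definition augmented_measure :: "real \<Rightarrow> diagram \<Rightarrow> diagram \<Rightarrow> real measure" where
  "augmented_measure \<theta> D D' =
     dirac_sum (image_mset (proj_angle \<theta>) D + image_mset (proj_angle \<theta> \<circ> proj_diag) D')"

text \<open>The Wasserstein distance below is between finitely supported measures of equal total mass,
  hence finite, so nothing is lost in passing to real numbers.\<close>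

definition sliced_wasserstein :: "diagram \<Rightarrow> diagram \<Rightarrow> real" where
  "sliced_wasserstein D1 D2 =
     1 / pi * (LINT \<theta>:{- pi / 2..pi / 2}|lborel.
       enn2real (wasserstein1 (augmented_measure \<theta> D1 D2) (augmented_measure \<theta> D2 D1)))"


section \<open>Kernels and the RKHS metric\<close>

definition sw_kernel :: "(nat \<Rightarrow> real) \<Rightarrow> nat \<Rightarrow> graded_diagram \<Rightarrow> graded_diagram \<Rightarrow> real" where
  "sw_kernel \<sigma> q D D' = exp (- sliced_wasserstein (D q) (D' q) / (2 * (\<sigma> q)\<^sup>2))"

definition combined_kernel ::
    "nat \<Rightarrow> (nat \<Rightarrow> real) \<Rightarrow> (nat \<Rightarrow> real) \<Rightarrow> graded_diagram \<Rightarrow> graded_diagram \<Rightarrow> real" where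
  "combined_kernel Q \<sigma> lam D D' = (\<Sum>q\<le>Q. lam q * sw_kernel \<sigma> q D D')"

text \<open>The Hilbert space \<open>'h\<close>, whose elements \<open>f\<close> are regarded as the functions \<open>fn f\<close> on \<open>X\<close>, is
  the reproducing kernel Hilbert space of \<open>k\<close>, and \<open>\<phi>\<close> is the canonical feature map: elements of
  \<open>'h\<close> are determined by their values on \<open>X\<close>, \<open>\<phi> x\<close> is the function \<open>k x\<close>, and point evaluation
  at \<open>x\<close> is the inner product with \<open>\<phi> x\<close> (so \<open>fn\<close> is linear on \<open>X\<close>).\<close>

definition is_rkhs ::
    "'x set \<Rightarrow> ('x \<Rightarrow> 'x \<Rightarrow> real) \<Rightarrow> ('h::{real_inner, complete_space} \<Rightarrow> 'x \<Rightarrow> real) \<Rightarrow> ('x \<Rightarrow> 'h) \<Rightarrow> bool"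
  where
  "is_rkhs X k fn \<phi> \<longleftrightarrow>
     (\<forall>f g. (\<forall>x\<in>X. fn f x = fn g x) \<longrightarrow> f = g) \<and>
     (\<forall>x\<in>X. \<forall>y\<in>X. fn (\<phi> x) y = k x y) \<and>
     (\<forall>f. \<forall>x\<in>X. fn f x = f \<bullet> \<phi> x)"

definition rkhs_metric :: "('x \<Rightarrow> 'h::real_normed_vector) \<Rightarrow> 'x \<Rightarrow> 'x \<Rightarrow> real" where
  "rkhs_metric \<phi> x y = norm (\<phi> x - \<phi> y)"

definition kappa :: "nat \<Rightarrow> (nat \<Rightarrow> real) \<Rightarrow> (nat \<Rightarrow> real) \<Rightarrow> nat \<Rightarrow> real" where
  "kappa N \<sigma> T q =
     (1 - exp (- T q)) / (2 * (\<sigma> q)\<^sup>2 * T q * (1 + 2 * real N * (2 * real N - 1)))"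

end

theory Submission
  imports Defs
begin

text \<open>
  The squared metric is the \<open>\<lambda>\<^sub>q\<close>-weighted sum of \<open>2 (1 - exp (- SW / (2 \<sigma>\<^sub>q\<^sup>2)))\<close>, and the chord of
  \<open>1 - exp (- u)\<close> over \<open>[0, T\<^sub>q]\<close> reduces the claim to \<open>d\<^sub>1 \<le> 2 M SW\<close>.

  At each angle \<open>\<theta>\<close>, the Wasserstein distance of the projections is the least projected cost of a
  bijection \<open>\<gamma>\<close> between the augmented diagrams (attained by sorting).  A vector \<open>v\<close> has a projection
  of length \<open>\<parallel>v\<parallel> |sin (\<theta> - \<beta>)|\<close>, where \<open>\<beta>\<close> is the angle orthogonal to \<open>v\<close>, and the sum of \<open>\<parallel>p - \<gamma> p\<parallel>\<close>
  over the pairs which are not both diagonal is at least \<open>d\<^sub>1\<close>.  There are only \<open>K \<le> 3 N\<^sup>2 \<le> M\<close>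
  such pairs, hence as many bad angles \<open>\<beta>\<close>, whatever \<open>\<gamma>\<close> is.  With \<open>c = 1 / M\<close> the distance at \<open>\<theta>\<close> is
  therefore at least \<open>d\<^sub>1\<close> times \<open>c\<close> minus the sum over the bad angles of the positive parts of
  \<open>c - |sin (\<theta> - \<beta>)|\<close>.  By Jordan's inequality each positive part integrates to at most \<open>c\<^sup>2 \<pi> / 2\<close>, so
  that the integral is at least \<open>d\<^sub>1 (c \<pi> - M c\<^sup>2 \<pi> / 2) = d\<^sub>1 \<pi> / (2 M)\<close>.
\<close>

section \<open>The Wasserstein distance of sums of Dirac measures\<close>

text \<open>Indices carry the multiplicities. As a pushforward of counting measure, such a sum gets
  couplings by pushing forward pairs of points.\<close>

lemma dirac_sum_eq_distr:
  assumes "finite I"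
  shows "dirac_sum (image_mset f (mset_set I)) = distr (count_space I) borel f"
proof (rule measure_eqI)
  fix A assume "A \<in> sets (dirac_sum (image_mset f (mset_set I)))"
  then have A: "A \<in> sets borel" by simp
  have "emeasure (distr (count_space I) borel f) A = of_nat (card (f -` A \<inter> I))"
    using A assms by (subst emeasure_distr) (auto simp: emeasure_count_space)
  also have "\<dots> = (\<Sum>i\<in>f -` A \<inter> I. 1)"
    by simp
  also have "\<dots> = (\<Sum>i\<in>I. indicator A (f i))"
    using assms by (intro sum.mono_neutral_cong_left) (auto simp: indicator_def)
  finally show "emeasure (dirac_sum (image_mset f (mset_set I))) A =
      emeasure (distr (count_space I) borel f) A"
    using A by (simp add: emeasure_dirac_sum sum_unfold_sum_mset image_mset.compositionality comp_def)
qed simp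

lemma emeasure_dirac_sum_indexed:
  assumes "finite I" "A \<in> sets borel"
  shows "emeasure (dirac_sum (image_mset f (mset_set I))) A = (\<Sum>i\<in>I. indicator A (f i))"
  using assms(2) by (simp add: emeasure_dirac_sum sum_unfold_sum_mset image_mset.compositionality comp_def)

section \<open>Mass that a coupling carries across a level\<close>

lemma measurable_straddle [measurable]:
  fixes t :: real
  shows "{z. fst z \<le> t \<and> t < snd z} \<in> sets (borel \<Otimes>\<^sub>M borel)"
    and "{z. snd z \<le> t \<and> t < fst z} \<in> sets (borel \<Otimes>\<^sub>M borel)"
proof -
  have "{z. fst z \<le> t \<and> t < snd z} = {..t} \<times> {t<..}" "{z. snd z \<le> t \<and> t < fst z} = {t<..} \<times> {..t}"
    by auto
  then show "{z. fst z \<le> t \<and> t < snd z} \<in> sets (borel \<Otimes>\<^sub>M borel)"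
    and "{z. snd z \<le> t \<and> t < fst z} \<in> sets (borel \<Otimes>\<^sub>M borel)"
    by simp_all
qed

lemma measurable_snd_halfspace:
  fixes t :: real
  shows "{z :: real \<times> real. snd z \<le> t} \<in> sets (borel \<Otimes>\<^sub>M borel)"
proof -
  have "{z. snd z \<le> t} = (UNIV :: real set) \<times> {..t}" by auto
  also have "\<dots> \<in> sets (borel \<Otimes>\<^sub>M borel)" by (intro pair_measureI) auto
  finally show ?thesis .
qed

text \<open>By \<open>imp\<close> no index crosses \<open>t\<close> downwards, so the left side is
  exactly the surplus of the \<open>x i\<close> over the \<open>y i\<close> in \<open>{..t}\<close>.
  A coupling has to send this surplus above \<open>t\<close>.\<close>

lemma emeasure_coupling_ge:
  fixes x y :: "nat \<Rightarrow> real"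
  assumes \<gamma>: "\<gamma> \<in> couplings (dirac_sum (image_mset x (mset_set I))) (dirac_sum (image_mset y (mset_set I)))"
    and "finite I" and imp: "\<And>i. i \<in> I \<Longrightarrow> y i \<le> t \<Longrightarrow> x i \<le> t"
  shows "(\<Sum>i\<in>I. indicator {x i..<y i} t) \<le> emeasure \<gamma> {z. fst z \<le> t \<and> t < snd z}"
proof -
  have sets: "sets \<gamma> = sets (borel \<Otimes>\<^sub>M borel)"
    and d: "distr \<gamma> borel fst = dirac_sum (image_mset x (mset_set I))"
           "distr \<gamma> borel snd = dirac_sum (image_mset y (mset_set I))"
    using \<gamma> by (auto simp: couplings_def)
  note [measurable_cong] = sets
  have space: "space \<gamma> = UNIV"
    using sets_eq_imp_space_eq[OF sets] by (simp add: space_pair_measure)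
  let ?B = "{z. fst z \<le> t \<and> t < snd z}"
  have [measurable]: "?B \<in> sets \<gamma>"
    using measurable_straddle by (simp add: sets)
  have [measurable]: "{z. snd z \<le> t} \<in> sets \<gamma>"
    using measurable_snd_halfspace by (simp add: sets)
  have fst: "emeasure \<gamma> {z. fst z \<le> t} = (\<Sum>i\<in>I. indicator {..t} (x i))"
    using arg_cong[OF d(1), of "\<lambda>M. emeasure M {..t}"] \<open>finite I\<close>
    by (simp add: emeasure_distr emeasure_dirac_sum_indexed space vimage_def)
  have snd: "emeasure \<gamma> {z. snd z \<le> t} = (\<Sum>i\<in>I. indicator {..t} (y i))"
    using arg_cong[OF d(2), of "\<lambda>M. emeasure M {..t}"] \<open>finite I\<close>
    by (simp add: emeasure_distr emeasure_dirac_sum_indexed space vimage_def)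
  have "(\<Sum>i\<in>I. indicator {x i..<y i} t) + (\<Sum>i\<in>I. indicator {..t} (y i)) = 
      (\<Sum>i\<in>I. indicator {..t} (x i) :: ennreal)"
    unfolding sum.distrib[symmetric] using imp
    by (intro sum.cong) (auto simp: indicator_def)
  also have "\<dots> \<le> emeasure \<gamma> (?B \<union> {z. snd z \<le> t})"
    unfolding fst[symmetric] by (intro emeasure_mono) auto
  also have "\<dots> \<le> emeasure \<gamma> ?B + emeasure \<gamma> {z. snd z \<le> t}"
    by (intro emeasure_subadditive) auto
  finally have "(\<Sum>i\<in>I. indicator {..t} (y i)) + (\<Sum>i\<in>I. indicator {x i..<y i} t) \<le>
      (\<Sum>i\<in>I. indicator {..t} (y i)) + emeasure \<gamma> ?B"
    unfolding snd by (simp only: add.commute)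
  \<comment> \<open>Cancelling a summand in \<open>ennreal\<close> requires it to be finite.\<close>
  moreover have "(\<Sum>i\<in>I. indicator {..t} (y i)) \<noteq> (\<top> :: ennreal)"
    using \<open>finite I\<close> by (auto simp: indicator_def)
  ultimately show ?thesis
    unfolding ennreal_add_left_cancel_le infinity_ennreal_def by blast
qed

text \<open>Reduces downward crossings of a level to upward ones.\<close>

lemma couplings_swap:
  assumes "\<gamma> \<in> couplings \<mu> \<nu>"
  shows "distr \<gamma> (borel \<Otimes>\<^sub>M borel) prod.swap \<in> couplings \<nu> \<mu>"
proof -
  have sets [measurable_cong]: "sets \<gamma> = sets (borel \<Otimes>\<^sub>M borel)"
    and d: "distr \<gamma> borel fst = \<mu>" "distr \<gamma> borel snd = \<nu>"
    using assms by (auto simp: couplings_def)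
  have [measurable]: "prod.swap \<in> \<gamma> \<rightarrow>\<^sub>M (borel \<Otimes>\<^sub>M borel)"
    unfolding prod.swap_def by measurable
  show ?thesis
    unfolding couplings_def by (auto simp: distr_distr d comp_def)
qed

text \<open>Layer cake: \<open>|x - y|\<close> is the measure of the levels \<open>t\<close> between \<open>x\<close> and \<open>y\<close>.  Sorted families never
  cross a level in both directions, so the mass that any coupling must carry across \<open>t\<close> is already
  the number of indices \<open>i\<close> for which \<open>t\<close> lies between \<open>x i\<close> and \<open>y i\<close>.\<close>

lemma coupling_cost_ge_sorted:
  fixes x y :: "nat \<Rightarrow> real"
  assumes \<gamma>: "\<gamma> \<in> couplings (dirac_sum (image_mset x (mset_set {..<n})))
                         (dirac_sum (image_mset y (mset_set {..<n})))"
    and x: "mono_on {..<n} x" and y: "mono_on {..<n} y"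
  shows "ennreal (\<Sum>i<n. \<bar>x i - y i\<bar>) \<le> (\<integral>\<^sup>+ z. ennreal \<bar>fst z - snd z\<bar> \<partial>\<gamma>)"
proof -
  have sets: "sets \<gamma> = sets (borel \<Otimes>\<^sub>M borel)"
    and d: "distr \<gamma> borel fst = dirac_sum (image_mset x (mset_set {..<n}))"
    using \<gamma> by (auto simp: couplings_def)
  note [measurable_cong] = sets
  have space: "space \<gamma> = UNIV"
    using sets_eq_imp_space_eq[OF sets] by (simp add: space_pair_measure)
  \<comment> \<open>The total mass is \<open>n\<close>, so \<gamma> is finite and the Fubini step
    below is available.\<close>
  have "emeasure \<gamma> UNIV = (\<Sum>i<n. indicator UNIV (x i))"
    using arg_cong[OF d, of "\<lambda>M. emeasure M UNIV"]
    by (simp add: emeasure_distr emeasure_dirac_sum_indexed space)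
  then interpret \<gamma>: finite_measure \<gamma>
    by (intro finite_measureI) (simp add: space)
  interpret pair_sigma_finite \<gamma> lborel ..
  \<comment> \<open>At least one of the two intervals is empty. Half-open intervals match the events
    \<open>fst z \<le> t \<and> t < snd z\<close> and their mirror images exactly.\<close>
  define J :: "real \<Rightarrow> real \<Rightarrow> real set" where "J a b = {a..<b} \<union> {b..<a}" for a b
  have J: "(\<integral>\<^sup>+ t. indicator (J a b) t \<partial>lborel) = ennreal \<bar>a - b\<bar>" for a b
    unfolding J_def by (cases "a \<le> b") auto
  have ineq: "(\<Sum>i<n. indicator (J (x i) (y i)) t) \<le> (\<integral>\<^sup>+ z. indicator (J (fst z) (snd z)) t \<partial>\<gamma>)" for t
  proof -
    let ?A = "{z. fst z \<le> t \<and> t < snd z}" and ?B = "{z. snd z \<le> t \<and> t < fst z}"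
    have [measurable]: "?A \<in> sets \<gamma>" "?B \<in> sets \<gamma>"
      using measurable_straddle by (simp_all add: sets)
    have R: "(\<integral>\<^sup>+ z. indicator (J (fst z) (snd z)) t \<partial>\<gamma>) = emeasure \<gamma> (?A \<union> ?B)"
    proof -
      have "(\<integral>\<^sup>+ z. indicator (J (fst z) (snd z)) t \<partial>\<gamma>) = (\<integral>\<^sup>+ z. indicator (?A \<union> ?B) z \<partial>\<gamma>)"
        by (intro nn_integral_cong) (auto simp: J_def indicator_def)
      also have "\<dots> = emeasure \<gamma> (?A \<union> ?B)"
        by (intro nn_integral_indicator sets.Un) measurable
      finally show ?thesis .
    qed
    \<comment> \<open>If \<open>i\<close> crosses \<open>t\<close> downwards, no \<open>j\<close>
      crosses it upwards: \<open>x j\<close> is above \<open>t\<close> when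
      \<open>i \<le> j\<close>, and \<open>y j\<close> is at most \<open>t\<close> when
      \<open>j \<le> i\<close>.\<close>
    consider "\<And>i. i < n \<Longrightarrow> y i \<le> t \<Longrightarrow> x i \<le> t" | "\<And>i. i < n \<Longrightarrow> x i \<le> t \<Longrightarrow> y i \<le> t"
    proof (cases "\<exists>i<n. y i \<le> t \<and> t < x i")
      case True
      then obtain i where i: "i < n" "y i \<le> t" "t < x i" by auto
      have "y j \<le> t" if "j < n" "x j \<le> t" for j
        using mono_onD[OF x, of i j] mono_onD[OF y, of j i] i that by (cases "i \<le> j") auto
      then show ?thesis using that(2) by blast
    next
      case False
      then show ?thesis using that(1) by force
    qed
    then show ?thesis
    proof cases
      case 1
      have "(\<Sum>i<n. indicator (J (x i) (y i)) t) = (\<Sum>i<n. indicator {x i..<y i} t :: ennreal)"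
        using 1 by (intro sum.cong) (force simp: J_def indicator_def)+
      also have "\<dots> \<le> emeasure \<gamma> ?A"
        using 1 by (intro emeasure_coupling_ge[OF \<gamma>]) auto
      also have "\<dots> \<le> emeasure \<gamma> (?A \<union> ?B)" by (intro emeasure_mono) auto
      finally show ?thesis unfolding R .
    next
      case 2
      have [measurable]: "prod.swap \<in> \<gamma> \<rightarrow>\<^sub>M (borel \<Otimes>\<^sub>M borel)"
        unfolding prod.swap_def by measurable
      have "(\<Sum>i<n. indicator (J (x i) (y i)) t) = (\<Sum>i<n. indicator {y i..<x i} t :: ennreal)"
        using 2 by (intro sum.cong) (force simp: J_def indicator_def)+
      also have "\<dots> \<le> emeasure (distr \<gamma> (borel \<Otimes>\<^sub>M borel) prod.swap) ?A"
        using 2 by (intro emeasure_coupling_ge[OF couplings_swap[OF \<gamma>]]) auto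
      also have "\<dots> = emeasure \<gamma> ?B"
        by (subst emeasure_distr) (auto simp: space intro!: arg_cong[where f="emeasure \<gamma>"])
      also have "\<dots> \<le> emeasure \<gamma> (?A \<union> ?B)" by (intro emeasure_mono) auto
      finally show ?thesis unfolding R .
    qed
  qed
  have "ennreal (\<Sum>i<n. \<bar>x i - y i\<bar>) = (\<Sum>i<n. \<integral>\<^sup>+ t. indicator (J (x i) (y i)) t \<partial>lborel)"
    by (simp add: J)
  also have "\<dots> = (\<integral>\<^sup>+ t. (\<Sum>i<n. indicator (J (x i) (y i)) t) \<partial>lborel)"
    by (rule nn_integral_sum[symmetric]) (simp add: J_def)
  also have "\<dots> \<le> (\<integral>\<^sup>+ t. \<integral>\<^sup>+ z. indicator (J (fst z) (snd z)) t \<partial>\<gamma> \<partial>lborel)"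
    by (intro nn_integral_mono ineq)
  also have "\<dots> = (\<integral>\<^sup>+ z. \<integral>\<^sup>+ t. indicator (J (fst z) (snd z)) t \<partial>lborel \<partial>\<gamma>)"
  proof (rule Fubini')
    have "(\<lambda>(z, t). indicator (J (fst z) (snd z)) t) =
        (\<lambda>w. if fst (fst w) \<le> snd w \<and> snd w < snd (fst w) \<or> snd (fst w) \<le> snd w \<and> snd w < fst (fst w)
              then 1 else 0 :: ennreal)"
      by (auto simp: J_def fun_eq_iff)
    then show "(\<lambda>(z, t). indicator (J (fst z) (snd z)) t :: ennreal) \<in> borel_measurable (\<gamma> \<Otimes>\<^sub>M lborel)"
      by simp
  qed
  also have "\<dots> = (\<integral>\<^sup>+ z. ennreal \<bar>fst z - snd z\<bar> \<partial>\<gamma>)"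
    by (simp add: J)
  finally show ?thesis .
qed

section \<open>Optimal couplings are bijections\<close>

lemma obtain_sorting_permutation:
  fixes x :: "nat \<Rightarrow> 'a::linorder"
  obtains f where "f permutes {..<n}" "mono_on {..<n} (x \<circ> f)"
proof -
  let ?xs = "map x [0..<n]"
  obtain f where f: "f permutes {..<n}" "permute_list f ?xs = sort ?xs"
    using mset_eq_permutation[of "sort ?xs" ?xs] by auto
  have "sort ?xs ! i = x (f i)" if "i < n" for i
  proof -
    have "f i < n" using permutes_in_image[OF f(1)] that by auto
    then show ?thesis using f that by (simp flip: f(2) add: permute_list_nth)
  qed
  moreover have "sort ?xs ! i \<le> sort ?xs ! j" if "i \<le> j" "j < n" for i j
    using that by (intro sorted_nth_mono) auto
  ultimately have "mono_on {..<n} (x \<circ> f)"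
    by (auto simp: mono_on_def)
  with f(1) show thesis by (rule that)
qed

lemma image_mset_permutes:
  assumes "p permutes I"
  shows "image_mset (f \<circ> p) (mset_set I) = image_mset f (mset_set I)"
proof -
  have "image_mset p (mset_set I) = mset_set I"
    using assms by (simp add: image_mset_mset_set permutes_inj_on permutes_image)
  then show ?thesis by (metis image_mset.compositionality)
qed

text \<open>The coupling is the pushforward of counting measure along
  \<open>i \<mapsto> (x i, y (p i))\<close>; permuting the indices does not change the second
  marginal.\<close>

lemma wasserstein1_le_permutation:
  fixes x y :: "nat \<Rightarrow> real"
  assumes p: "p permutes {..<n}"
  shows "wasserstein1 (dirac_sum (image_mset x (mset_set {..<n})))
           (dirac_sum (image_mset y (mset_set {..<n}))) \<le> ennreal (\<Sum>i<n. \<bar>x i - y (p i)\<bar>)"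
proof -
  let ?C = "count_space {..<n}"
  have [measurable]: "(\<lambda>i. (x i, y (p i))) \<in> ?C \<rightarrow>\<^sub>M borel \<Otimes>\<^sub>M borel"
    by (simp add: space_pair_measure)
  let ?\<gamma> = "distr ?C (borel \<Otimes>\<^sub>M borel) (\<lambda>i. (x i, y (p i)))"
  have "distr ?\<gamma> borel fst = dirac_sum (image_mset x (mset_set {..<n}))"
    by (simp add: dirac_sum_eq_distr distr_distr comp_def space_pair_measure)
  moreover have "distr ?\<gamma> borel snd = dirac_sum (image_mset y (mset_set {..<n}))"
    by (subst image_mset_permutes[OF p, symmetric])
      (simp add: dirac_sum_eq_distr distr_distr comp_def space_pair_measure)
  ultimately have \<gamma>: "?\<gamma> \<in> couplings (dirac_sum (image_mset x (mset_set {..<n})))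
      (dirac_sum (image_mset y (mset_set {..<n})))"
    by (simp add: couplings_def)
  have "(\<integral>\<^sup>+ z. ennreal \<bar>fst z - snd z\<bar> \<partial>?\<gamma>) = ennreal (\<Sum>i<n. \<bar>x i - y (p i)\<bar>)"
    by (subst nn_integral_distr) (simp_all add: nn_integral_count_space_finite space_pair_measure)
  then show ?thesis
    using INF_lower[OF \<gamma>, of "\<lambda>\<gamma>. \<integral>\<^sup>+ z. ennreal \<bar>fst z - snd z\<bar> \<partial>\<gamma>"]
    by (simp only: wasserstein1_def)
qed

lemma wasserstein1_ge_permutation:
  fixes x y :: "nat \<Rightarrow> real"
  obtains p where "p permutes {..<n}"
    "ennreal (\<Sum>i<n. \<bar>x i - y (p i)\<bar>) \<le> wasserstein1 (dirac_sum (image_mset x (mset_set {..<n})))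
       (dirac_sum (image_mset y (mset_set {..<n})))"
proof -
  obtain f where f: "f permutes {..<n}" "mono_on {..<n} (x \<circ> f)"
    by (rule obtain_sorting_permutation)
  obtain g where g: "g permutes {..<n}" "mono_on {..<n} (y \<circ> g)"
    by (rule obtain_sorting_permutation)
  \<comment> \<open>The permutation \<open>g \<circ> inv f\<close> pairs entries of equal rank in
    the two sorted families.\<close>
  have "(\<Sum>i<n. \<bar>x i - y ((g \<circ> inv f) i)\<bar>) = (\<Sum>i<n. \<bar>(x \<circ> f) i - (y \<circ> g) i\<bar>)"
    using f(1) by (subst sum.permute[OF f(1)]) (simp add: comp_def permutes_inverses)
  moreover have "ennreal (\<Sum>i<n. \<bar>(x \<circ> f) i - (y \<circ> g) i\<bar>) \<le>
      wasserstein1 (dirac_sum (image_mset x (mset_set {..<n}))) (dirac_sum (image_mset y (mset_set {..<n})))"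
    unfolding wasserstein1_def
  proof (rule INF_greatest)
    fix \<gamma> assume "\<gamma> \<in> couplings (dirac_sum (image_mset x (mset_set {..<n})))
      (dirac_sum (image_mset y (mset_set {..<n})))"
    then show "ennreal (\<Sum>i<n. \<bar>(x \<circ> f) i - (y \<circ> g) i\<bar>) \<le> (\<integral>\<^sup>+ z. ennreal \<bar>fst z - snd z\<bar> \<partial>\<gamma>)"
      using coupling_cost_ge_sorted[OF _ f(2) g(2)] by (simp only: image_mset_permutes f(1) g(1))
  qed
  moreover have "g \<circ> inv f permutes {..<n}"
    by (intro permutes_compose permutes_inv f g)
  ultimately show thesis using that by metis
qed

text \<open>The form as a minimum over finitely many permutations serves twice: it will be
  continuous in the angle, and a lower bound for it may treat each bijection separately.\<close>

theorem wasserstein1_dirac_sum: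
  fixes x y :: "nat \<Rightarrow> real"
  shows "wasserstein1 (dirac_sum (image_mset x (mset_set {..<n})))
           (dirac_sum (image_mset y (mset_set {..<n}))) =
         ennreal (MIN p\<in>{p. p permutes {..<n}}. \<Sum>i<n. \<bar>x i - y (p i)\<bar>)"
    (is "?W = ennreal (Min (?c ` ?P))")
proof (rule antisym)
  have fin: "finite ?P" by (simp add: finite_permutations)
  have ne: "?P \<noteq> {}" using permutes_id by blast
  have "Min (?c ` ?P) \<in> ?c ` ?P" using fin ne by (intro Min_in) auto
  then obtain p where p: "p \<in> ?P" "Min (?c ` ?P) = ?c p" by auto
  then show "?W \<le> ennreal (Min (?c ` ?P))" using wasserstein1_le_permutation[of p n x y] by simp
  obtain p where "p permutes {..<n}" "ennreal (?c p) \<le> ?W" by (rule wasserstein1_ge_permutation)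
  moreover from this(1) have "Min (?c ` ?P) \<le> ?c p" using fin by (intro Min_le) auto
  ultimately show "ennreal (Min (?c ` ?P)) \<le> ?W" by (meson ennreal_leI order_trans)
qed

section \<open>Matchings from permutations\<close>

text \<open>Pythagoras: \<open>proj_diag p\<close> is the foot of the perpendicular from
  \<open>p\<close>, and \<open>proj_diag q\<close> is an arbitrary point of the line.\<close>

lemma norm_minus_proj_diag_le: "norm (p - proj_diag p) \<le> norm (p - proj_diag q)"
proof -
  obtain x y where p: "p = (x, y)" by (cases p)
  define t where "t = (fst q + snd q) / 2"
  have "(x - t)\<^sup>2 + (y - t)\<^sup>2 - ((x - (x + y) / 2)\<^sup>2 + (y - (x + y) / 2)\<^sup>2) = 2 * (t - (x + y) / 2)\<^sup>2"
    by (simp add: power2_eq_square field_simps)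
  also have "\<dots> \<ge> 0" by simp
  finally show ?thesis
    by (simp add: p proj_diag_def norm_prod_def t_def[symmetric])
qed

lemma sum_mset_nonneg:
  fixes f :: "'a \<Rightarrow> real"
  assumes "\<And>x. x \<in># M \<Longrightarrow> 0 \<le> f x"
  shows "0 \<le> (\<Sum>x\<in>#M. f x)"
  using assms by (induction M) auto

lemma matching_cost_nonneg: "0 \<le> matching_cost D1 D2 G"
  unfolding matching_cost_def by (intro add_nonneg_nonneg sum_mset_nonneg) (auto simp: infnorm_pos_le)

lemma diagram_dist_nonneg: "0 \<le> diagram_dist D1 D2"
proof -
  have "{#} \<in> partial_matchings D1 D2" by (simp add: partial_matchings_def)
  then show ?thesis
    unfolding diagram_dist_def by (intro cINF_greatest) (auto intro: matching_cost_nonneg)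
qed

lemma diagram_dist_le: "G \<in> partial_matchings D1 D2 \<Longrightarrow> diagram_dist D1 D2 \<le> matching_cost D1 D2 G"
  unfolding diagram_dist_def by (intro cINF_lower bdd_belowI2[of _ 0] matching_cost_nonneg)

lemma image_mset_mset_set_Diff:
  assumes "finite A" "B \<subseteq> A"
  shows "image_mset f (mset_set A) - image_mset f (mset_set B) = image_mset f (mset_set (A - B))"
  using assms by (simp add: mset_set_Diff image_mset_Diff subset_imp_msubset_mset_set)

text \<open>Indices below \<open>a\<close> and \<open>b\<close> are genuine points, the others
  diagonal ones. Keeping only the genuine pairs gives a partial matching; a genuine point paired
  with a diagonal one becomes unmatched, at no greater cost since its own projection is nearest and
  \<open>infnorm\<close> is at most \<open>norm\<close>.\<close>

lemma diagram_dist_le_permutation: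
  fixes x y :: "nat \<Rightarrow> real \<times> real"
  assumes D1: "D1 = image_mset x (mset_set {..<a})" and D2: "D2 = image_mset y (mset_set {..<b})"
    and x: "\<And>i. a \<le> i \<Longrightarrow> i < a + b \<Longrightarrow> x i \<in> range proj_diag"
    and y: "\<And>j. b \<le> j \<Longrightarrow> j < a + b \<Longrightarrow> y j \<in> range proj_diag"
    and p: "p permutes {..<a + b}"
  shows "diagram_dist D1 D2 \<le> (\<Sum>i | i < a + b \<and> (i < a \<or> p i < b). norm (x i - y (p i)))"
proof -
  define A B C where "A = {i. i < a \<and> p i < b}" and "B = {i. i < a \<and> b \<le> p i}"
    and "C = {i. a \<le> i \<and> i < a + b \<and> p i < b}"
  define G where "G = image_mset (\<lambda>i. (x i, y (p i))) (mset_set A)"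
  have fin: "finite A" "finite B" "finite C" by (auto simp: A_def B_def C_def)
  have inj: "inj_on p S" for S using p by (rule permutes_inj_on)
  have sub: "A \<subseteq> {..<a}" "p ` A \<subseteq> {..<b}" by (auto simp: A_def)
  have diff: "{..<a} - A = B" by (auto simp: A_def B_def)
  have diff': "{..<b} - p ` A = p ` C"
  proof (intro equalityI subsetI)
    fix j assume j: "j \<in> {..<b} - p ` A"
    then have "j \<in> p ` {..<a + b}" using permutes_image[OF p] by auto
    then obtain i where "i < a + b" "j = p i" by auto
    with j have "i \<in> C" by (auto simp: A_def C_def)
    with \<open>j = p i\<close> show "j \<in> p ` C" by blast
  next
    fix j assume "j \<in> p ` C"
    then obtain i where i: "i \<in> C" "j = p i" by blast
    moreover have "i \<notin> A" using i by (auto simp: A_def C_def)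
    ultimately show "j \<in> {..<b} - p ` A"
      using inj_image_mem_iff[OF permutes_inj[OF p]] by (auto simp: C_def)
  qed
  have fstG: "image_mset fst G = image_mset x (mset_set A)"
    by (simp add: G_def image_mset.compositionality comp_def)
  have sndG: "image_mset snd G = image_mset y (mset_set (p ` A))"
    by (simp add: G_def image_mset.compositionality comp_def flip: image_mset_mset_set[OF inj])
  have "G \<in> partial_matchings D1 D2"
    unfolding partial_matchings_def mem_Collect_eq fstG sndG D1 D2 using sub
    by (intro conjI image_mset_subseteq_mono subset_imp_msubset_mset_set) auto
  then have "diagram_dist D1 D2 \<le> matching_cost D1 D2 G" by (rule diagram_dist_le)
  also have "\<dots> = (\<Sum>i\<in>A. infnorm (x i - y (p i))) + ((\<Sum>i\<in>B. infnorm (x i - proj_diag (x i))) +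
      (\<Sum>i\<in>C. infnorm (y (p i) - proj_diag (y (p i)))))"
  proof -
    have "D1 - image_mset fst G = image_mset x (mset_set B)"
      unfolding fstG D1 using sub by (simp add: image_mset_mset_set_Diff diff)
    moreover have "D2 - image_mset snd G = image_mset y (mset_set (p ` C))"
      unfolding sndG D2 using sub by (simp add: image_mset_mset_set_Diff diff')
    moreover have "image_mset y (mset_set (p ` C)) = image_mset (\<lambda>i. y (p i)) (mset_set C)"
      by (simp add: image_mset.compositionality comp_def flip: image_mset_mset_set[OF inj])
    ultimately show ?thesis
      by (simp add: matching_cost_def G_def image_mset.compositionality comp_def sum_unfold_sum_mset)
  qed
  also have "\<dots> \<le> (\<Sum>i\<in>A. norm (x i - y (p i))) + ((\<Sum>i\<in>B. norm (x i - y (p i))) +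
      (\<Sum>i\<in>C. norm (x i - y (p i))))"
  proof (intro add_mono sum_mono)
    fix i assume "i \<in> B"
    then have "b \<le> p i" "p i < a + b" using permutes_in_image[OF p, of i] by (auto simp: B_def)
    then obtain q where "y (p i) = proj_diag q" using y[of "p i"] by auto
    then show "infnorm (x i - proj_diag (x i)) \<le> norm (x i - y (p i))"
      by (metis order_trans[OF infnorm_le_norm norm_minus_proj_diag_le])
  next
    fix i assume "i \<in> C"
    then obtain q where "x i = proj_diag q" using x[of i] by (auto simp: C_def)
    then show "infnorm (y (p i) - proj_diag (y (p i))) \<le> norm (x i - y (p i))"
      by (metis order_trans[OF infnorm_le_norm norm_minus_proj_diag_le] norm_minus_commute)
  qed (simp add: infnorm_le_norm)
  also have "\<dots> = (\<Sum>i\<in>A \<union> (B \<union> C). norm (x i - y (p i)))"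
    using fin by (subst sum.union_disjoint; (subst sum.union_disjoint)?) (auto simp: A_def B_def C_def)
  also have "A \<union> (B \<union> C) = {i. i < a + b \<and> (i < a \<or> p i < b)}"
    by (auto simp: A_def B_def C_def)
  finally show ?thesis .
qed

section \<open>Integrals of truncated sines\<close>

text \<open>Jordan's inequality: the concave sine lies above its chord over
  \<open>{0..pi / 2}\<close>.\<close>

lemma sin_ge_linear:
  assumes "0 \<le> u" "u \<le> pi / 2"
  shows "2 / pi * u \<le> sin u"
proof -
  have "concave_on {0..pi / 2} sin"
    unfolding concave_on_def
  proof (rule convex_on_realI)
    fix s t assume "s \<in> {0..pi / 2}" "t \<in> {0..pi / 2}" "s \<le> t"
    then show "- cos s \<le> - cos t" by (simp add: cos_mono_le_eq)
  qed (auto intro!: derivative_eq_intros)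
  then have "(1 - 2 * u / pi) * sin 0 + (2 * u / pi) * sin (pi / 2) \<le>
      sin ((1 - 2 * u / pi) *\<^sub>R 0 + (2 * u / pi) *\<^sub>R (pi / 2))"
    using assms by (intro concave_onD) (auto simp: field_simps)
  then show ?thesis by simp
qed

lemma abs_sin_ge_linear:
  assumes "\<bar>u\<bar> \<le> pi / 2"
  shows "2 / pi * \<bar>u\<bar> \<le> \<bar>sin u\<bar>"
proof -
  have "2 / pi * \<bar>u\<bar> \<le> sin \<bar>u\<bar>" using assms by (intro sin_ge_linear) auto
  also have "\<dots> \<le> \<bar>sin u\<bar>" by (simp add: abs_if)
  finally show ?thesis .
qed

text \<open>For \<open>a \<le> b\<close>, the windows at \<open>a\<close> and \<open>b\<close>
  extend to \<open>{a..b + T}\<close> by \<open>{a + T..b + T}\<close> and \<open>{a..b}\<close>,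
  which are translates by \<open>T\<close>.\<close>

lemma integral_periodic:
  fixes f :: "real \<Rightarrow> real"
  assumes per: "\<And>u. f (u + T) = f u" and cont: "continuous_on UNIV f" and "0 \<le> T"
  shows "integral {a..a + T} f = integral {0..T} f"
proof -
  have int: "f integrable_on {c..d}" for c d
    using cont continuous_on_subset by (intro integrable_continuous_real) blast
  have shift: "integral {c + T..d + T} f = integral {c..d} f" for c d
  proof -
    have "integral {c + T..d + T} f = integral {c..d} (f \<circ> (+) T)"
      using integral_shift_Icc_real[of "c" "d" f T] by (simp add: comp_def add.commute)
    then show ?thesis by (simp add: comp_def per add.commute)
  qed
  have pos: "integral {a..a + T} f = integral {b..b + T} f" if "a \<le> b" for a b
  proof -
    have "integral {a..b} f + integral {b..b + T} f = integral {a..b + T} f"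
      using that \<open>0 \<le> T\<close> by (intro Henstock_Kurzweil_Integration.integral_combine int) auto
    moreover have "integral {a..a + T} f + integral {a + T..b + T} f = integral {a..b + T} f"
      using that \<open>0 \<le> T\<close> by (intro Henstock_Kurzweil_Integration.integral_combine int) auto
    ultimately show ?thesis using shift[of a b] by simp
  qed
  show ?thesis using pos[of a 0] pos[of 0 a] by (cases "a \<le> 0") auto
qed

text \<open>Since \<open>\<bar>sin u\<bar>\<close> has period \<open>pi\<close>, the length of the
  interval, the shift \<beta> is irrelevant. Jordan's inequality then dominates the integrand by a
  triangle of height \<open>c\<close> and base \<open>c * pi\<close>.\<close>

lemma integral_truncated_sin_le:
  assumes c: "0 \<le> c" "c \<le> 1"
  shows "integral {-pi/2..pi/2} (\<lambda>\<theta>. max 0 (c - \<bar>sin (\<theta> - \<beta>)\<bar>)) \<le> c\<^sup>2 * pi / 2"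
proof -
  let ?F = "\<lambda>u::real. max 0 (c - \<bar>sin u\<bar>)"
  let ?G = "\<lambda>u::real. max 0 (c - 2 / pi * \<bar>u\<bar>)"
  \<comment> \<open>The tent \<open>?G\<close> vanishes outside \<open>{-d..d}\<close>;
    \<open>c \<le> 1\<close> keeps this inside the interval of integration.\<close>
  define d where "d = c * pi / 2"
  have d: "0 \<le> d" "d \<le> pi / 2" using c by (auto simp: d_def field_simps)
  have contF: "continuous_on UNIV ?F" and contG: "continuous_on S ?G" for S
    by (intro continuous_intros; simp)+
  have "integral {-pi/2..pi/2} (\<lambda>\<theta>. ?F (\<theta> - \<beta>)) = integral {-pi/2 - \<beta>..-pi/2 - \<beta> + pi} ?F"
  proof -
    have "(\<lambda>\<theta>. ?F (\<theta> - \<beta>)) = ?F \<circ> (+) (- \<beta>)" "-pi/2 - \<beta> = -pi/2 + - \<beta>" "-pi/2 - \<beta> + pi = pi/2 + - \<beta>"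
      by (simp_all add: fun_eq_iff)
    then show ?thesis by (simp only: integral_shift_Icc_real)
  qed
  also have "\<dots> = integral {-pi/2..-pi/2 + pi} ?F"
    by (simp only: integral_periodic[OF _ contF, of pi] sin_periodic_pi abs_minus_cancel pi_ge_zero)
  also have "\<dots> = integral {-pi/2..pi/2} ?F"
    by simp
  also have "\<dots> \<le> integral {-pi/2..pi/2} ?G"
  proof (rule integral_le)
    show "?F integrable_on {-pi/2..pi/2}"
      by (rule integrable_continuous_real) (rule continuous_on_subset[OF contF subset_UNIV])
    show "?G integrable_on {-pi/2..pi/2}"
      by (rule integrable_continuous_real) (rule contG)
    fix u assume "u \<in> {-pi/2..pi/2}"
    then show "?F u \<le> ?G u"
      using abs_sin_ge_linear[of u] by (intro max.mono) auto
  qed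
  also have "\<dots> = c\<^sup>2 * pi / 2"
  proof (rule integral_unique)
    have z: "(?G has_integral 0) {-pi/2..-d}" "(?G has_integral 0) {d..pi/2}"
      by (rule has_integral_is_0; force simp: d_def field_simps max_def)+
    have l: "(?G has_integral c\<^sup>2 * pi / 4) {-d..0}"
    proof -
      have "((\<lambda>u. c + 2 / pi * u) has_integral (c * 0 + 1 / pi * 0\<^sup>2) - (c * (-d) + 1 / pi * (-d)\<^sup>2)) {-d..0}"
        using d by (intro fundamental_theorem_of_calculus)
          (auto intro!: derivative_eq_intros simp flip: has_real_derivative_iff_has_vector_derivative)
      also have "(c * 0 + 1 / pi * 0\<^sup>2) - (c * (-d) + 1 / pi * (-d)\<^sup>2) = c\<^sup>2 * pi / 4"
        by (simp add: d_def power2_eq_square field_simps)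
      finally show ?thesis
        by (rule has_integral_eq[rotated]) (auto simp: d_def field_simps max_def)
    qed
    have r: "(?G has_integral c\<^sup>2 * pi / 4) {0..d}"
    proof -
      have "((\<lambda>u. c - 2 / pi * u) has_integral (c * d - 1 / pi * d\<^sup>2) - (c * 0 - 1 / pi * 0\<^sup>2)) {0..d}"
        using d by (intro fundamental_theorem_of_calculus)
          (auto intro!: derivative_eq_intros simp flip: has_real_derivative_iff_has_vector_derivative)
      also have "(c * d - 1 / pi * d\<^sup>2) - (c * 0 - 1 / pi * 0\<^sup>2) = c\<^sup>2 * pi / 4"
        by (simp add: d_def power2_eq_square field_simps)
      finally show ?thesis
        by (rule has_integral_eq[rotated]) (auto simp: d_def field_simps max_def)
    qed
    have "(?G has_integral 0 + c\<^sup>2 * pi / 4) {-pi/2..0}"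
      using d by (intro has_integral_combine[OF _ _ z(1) l]) auto
    moreover have "(?G has_integral c\<^sup>2 * pi / 4 + 0) {0..pi/2}"
      using d by (intro has_integral_combine[OF _ _ r z(2)]) auto
    ultimately have "(?G has_integral (0 + c\<^sup>2 * pi / 4) + (c\<^sup>2 * pi / 4 + 0)) {-pi/2..pi/2}"
      by (intro has_integral_combine[of "-pi/2" 0 "pi/2"]) auto
    then show "(?G has_integral c\<^sup>2 * pi / 2) {-pi/2..pi/2}" by (simp add: mult.commute)
  qed
  finally show ?thesis .
qed

text \<open>The projection is \<open>norm v * cos (\<theta> - Arg z)\<close>; subtracting
  \<open>pi / 2\<close> from the argument turns the cosine into a sine.\<close>

lemma proj_angle_polar: "\<exists>\<beta>. \<forall>\<theta>. proj_angle \<theta> v = norm v * sin (\<theta> - \<beta>)"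
proof -
  define z where "z = Complex (fst v) (snd v)"
  have "norm v = cmod z" by (simp add: z_def norm_prod_def cmod_def)
  moreover have "fst v = cmod z * cos (Arg z)" "snd v = cmod z * sin (Arg z)"
    using rcis_cmod_Arg[of z] by (simp_all add: z_def complex_eq_iff)
  ultimately have "proj_angle \<theta> v = norm v * sin (\<theta> - (Arg z - pi / 2))" for \<theta>
    by (simp add: proj_angle_def inner_prod_def sin_diff cos_diff sin_add cos_add algebra_simps)
  then show ?thesis by blast
qed

section \<open>The sliced Wasserstein distance bounds the diagram distance\<close>

text \<open>A single indexing serves both multisets, with \<open>A\<close> listed first, so that the
  index alone tells genuine points from diagonal ones.\<close>

lemma obtain_indexing:
  obtains x where "A = image_mset x (mset_set {..<size A})"
    "A + B = image_mset x (mset_set {..<size A + size B})"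
    "\<And>i. size A \<le> i \<Longrightarrow> i < size A + size B \<Longrightarrow> x i \<in># B"
proof -
  obtain xs ys where xs: "A = mset xs" and ys: "B = mset ys"
    by (metis ex_mset)
  have nth: "mset zs = image_mset ((!) zs) (mset_set {..<length zs})" for zs :: "'a list"
    by (metis map_nth mset_map mset_set_upto_eq_mset_upto)
  have "image_mset ((!) (xs @ ys)) (mset_set {..<length xs}) = image_mset ((!) xs) (mset_set {..<length xs})"
    by (intro image_mset_cong) (simp add: nth_append)
  then show thesis
    using nth[of xs] nth[of "xs @ ys"] by (intro that[of "(!) (xs @ ys)"]) (auto simp: xs ys nth_append)
qed

lemma continuous_on_Min:
  fixes f :: "'i \<Rightarrow> 'a::topological_space \<Rightarrow> real"
  assumes "finite I" "I \<noteq> {}" "\<And>i. i \<in> I \<Longrightarrow> continuous_on S (f i)"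
  shows "continuous_on S (\<lambda>z. MIN i\<in>I. f i z)"
  using assms by (induction I rule: finite_ne_induct) (auto intro!: continuous_on_min)

text \<open>One indexing of the augmented diagrams works for all angles because projecting is
  linear. The integrand is then a minimum of finitely many continuous functions.\<close>

lemma sliced_wasserstein_indexed:
  fixes n :: nat
  assumes x: "D1 + image_mset proj_diag D2 = image_mset x (mset_set {..<n})"
    and y: "D2 + image_mset proj_diag D1 = image_mset y (mset_set {..<n})"
  defines "w \<equiv> \<lambda>\<theta>. MIN p\<in>{p. p permutes {..<n}}. \<Sum>i<n. \<bar>proj_angle \<theta> (x i - y (p i))\<bar>"
  shows "w integrable_on {-pi/2..pi/2}"
    and "sliced_wasserstein D1 D2 = 1 / pi * integral {-pi/2..pi/2} w"
proof -
  have fin: "finite {p. p permutes {..<n}}" by (simp add: finite_permutations)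
  have ne: "{p. p permutes {..<n}} \<noteq> {}" using permutes_id by blast
  have cont: "continuous_on S w" for S
    unfolding w_def proj_angle_def by (intro continuous_on_Min fin ne continuous_intros)
  have nonneg: "0 \<le> w \<theta>" for \<theta>
    unfolding w_def using fin ne by (subst Min_ge_iff) (auto intro: sum_nonneg)
  have aug: "augmented_measure \<theta> D D' = dirac_sum (image_mset (\<lambda>i. proj_angle \<theta> (z i)) (mset_set {..<n}))"
    if "D + image_mset proj_diag D' = image_mset z (mset_set {..<n})" for \<theta> D D' z
    using arg_cong[OF that, of "image_mset (proj_angle \<theta>)"]
    by (simp add: augmented_measure_def image_mset.compositionality comp_def)
  have "enn2real (wasserstein1 (augmented_measure \<theta> D1 D2) (augmented_measure \<theta> D2 D1)) = w \<theta>" for \<theta>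
    using nonneg[of \<theta>]
    by (simp add: aug[OF x] aug[OF y] wasserstein1_dirac_sum w_def proj_angle_def inner_diff_left)
  then have "sliced_wasserstein D1 D2 = 1 / pi * (LINT \<theta>:{-pi/2..pi/2}|lborel. w \<theta>)"
    by (simp add: sliced_wasserstein_def)
  also have "(LINT \<theta>:{-pi/2..pi/2}|lborel. w \<theta>) = integral {-pi/2..pi/2} w"
    by (intro set_borel_integral_eq_integral borel_integrable_atLeastAtMost' cont)
  finally show "sliced_wasserstein D1 D2 = 1 / pi * integral {-pi/2..pi/2} w" .
  show "w integrable_on {-pi/2..pi/2}"
    by (rule integrable_continuous_real[OF cont])
qed

lemma sliced_wasserstein_nonneg: "0 \<le> sliced_wasserstein D1 D2"
  unfolding sliced_wasserstein_def set_lebesgue_integral_def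
  by (intro mult_nonneg_nonneg Bochner_Integration.integral_nonneg) auto

text \<open>The identity permutation costs nothing. This makes every \<open>sw_kernel\<close> equal
  to 1 at \<open>(D, D)\<close>.\<close>

lemma sliced_wasserstein_self: "sliced_wasserstein D D = 0"
proof -
  have "wasserstein1 (dirac_sum M) (dirac_sum M) = 0" for M
  proof -
    obtain x where x: "M = image_mset x (mset_set {..<size M})" by (rule obtain_indexing[of M "{#}"])
    have "wasserstein1 (dirac_sum M) (dirac_sum M) \<le> 0"
      using wasserstein1_le_permutation[OF permutes_id, of x "size M" x] by (simp flip: x)
    then show ?thesis by simp
  qed
  then show ?thesis by (simp add: sliced_wasserstein_def augmented_measure_def)
qed

theorem diagram_dist_le_sliced_wasserstein:
  assumes N: "size D1 \<le> N" "size D2 \<le> N"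
  shows "diagram_dist D1 D2 \<le> 2 * (1 + 2 * real N * (2 * real N - 1)) * sliced_wasserstein D1 D2"
proof -
  define a b n where "a = size D1" and "b = size D2" and "n = a + b"
  define M where "M = 1 + 2 * real N * (2 * real N - 1)"
  \<comment> \<open>This threshold maximizes the final bound
    \<open>c * pi - M * (c\<^sup>2 * pi / 2)\<close>.\<close>
  define c where "c = 1 / M"
  define d where "d = diagram_dist D1 D2"
  have M1: "1 \<le> M"
  proof (cases N)
    case (Suc k)
    then show ?thesis by (simp add: M_def)
  qed (simp add: M_def)
  have c: "0 < c" "c \<le> 1" using M1 by (auto simp: c_def)
  have d0: "0 \<le> d" by (simp add: d_def diagram_dist_nonneg)

  obtain x where x: "D1 = image_mset x (mset_set {..<a})"
    "D1 + image_mset proj_diag D2 = image_mset x (mset_set {..<n})"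
    and x': "\<And>i. a \<le> i \<Longrightarrow> i < n \<Longrightarrow> x i \<in># image_mset proj_diag D2"
    using obtain_indexing[of D1 "image_mset proj_diag D2"] by (auto simp: a_def b_def n_def)
  obtain y where y: "D2 = image_mset y (mset_set {..<b})"
    "D2 + image_mset proj_diag D1 = image_mset y (mset_set {..<n})"
    and y': "\<And>i. b \<le> i \<Longrightarrow> i < n \<Longrightarrow> y i \<in># image_mset proj_diag D1"
    using obtain_indexing[of D2 "image_mset proj_diag D1"] by (auto simp: a_def b_def n_def add.commute)
  have dist: "d \<le> (\<Sum>i | i < n \<and> (i < a \<or> p i < b). norm (x i - y (p i)))" if "p permutes {..<n}" for p
    unfolding d_def n_def
  proof (intro diagram_dist_le_permutation x y)
    show "x i \<in> range proj_diag" if "a \<le> i" "i < a + b" for i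
      using x'[of i] that by (auto simp: n_def)
    show "y j \<in> range proj_diag" if "b \<le> j" "j < a + b" for j
      using y'[of j] that by (auto simp: n_def)
  qed (use that in \<open>simp add: n_def\<close>)

  obtain \<beta> where \<beta>: "\<And>\<theta> v. proj_angle \<theta> v = norm v * sin (\<theta> - \<beta> v)"
    using proj_angle_polar by metis
  \<comment> \<open>Pairs of two diagonal points are left out of \<open>K\<close>, since they cost nothing in
    \<open>diagram_dist\<close>; keeping them would make \<open>card K\<close> as large as \<open>4 * N\<^sup>2\<close>, more than \<open>M\<close>.\<close>
  define K where "K = {..<n} \<times> {..<n} - {a..<n} \<times> {b..<n}"
  define h where "h = (\<lambda>k \<theta>. max 0 (c - \<bar>sin (\<theta> - \<beta> (x (fst k) - y (snd k)))\<bar>))"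
  \<comment> \<open>One lower bound for the sines of all pairs in \<open>K\<close>. Subtracting the
    sum of the \<open>h k\<close> lets it be integrated term by term; it may be negative.\<close>
  define g where "g = (\<lambda>\<theta>. c - (\<Sum>k\<in>K. h k \<theta>))"
  have finK: "finite K" by (simp add: K_def)
  have "{a..<n} \<times> {b..<n} \<subseteq> {..<n} \<times> {..<n}" by auto
  then have "card K = n * n - b * a"
    unfolding K_def by (subst card_Diff_subset) (auto simp: n_def)
  also have "real \<dots> = real a * real a + real a * real b + real b * real b"
    by (simp add: n_def algebra_simps)
  also have "\<dots> \<le> real N * real N + real N * real N + real N * real N"
    using N by (intro add_mono mult_mono) (auto simp: a_def b_def)
  \<comment> \<open>The difference \<open>M - 3 * N\<^sup>2\<close> is
    \<open>(N - 1)\<^sup>2\<close>.\<close>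
  also have "\<dots> \<le> M"
    using zero_le_power2[of "real N - 1"] by (simp add: M_def power2_eq_square algebra_simps)
  finally have cardK: "real (card K) \<le> M" .

  have g_le: "g \<theta> \<le> \<bar>sin (\<theta> - \<beta> (x i - y j))\<bar>" if "(i, j) \<in> K" for i j \<theta>
  proof -
    have "c - \<bar>sin (\<theta> - \<beta> (x i - y j))\<bar> \<le> h (i, j) \<theta>" by (simp add: h_def)
    also have "\<dots> \<le> (\<Sum>k\<in>K. h k \<theta>)"
      using that finK by (intro member_le_sum) (auto simp: h_def)
    finally show ?thesis by (simp add: g_def)
  qed
  have cost: "d * g \<theta> \<le> (\<Sum>i<n. \<bar>proj_angle \<theta> (x i - y (p i))\<bar>)" if p: "p permutes {..<n}" for p \<theta>
  \<comment> \<open>Multiplying \<open>dist\<close> by \<open>g \<theta>\<close> needs its sign;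
    where it is negative, the left side is at most 0 and the cost at least 0.\<close>
  proof (cases "0 \<le> g \<theta>")
    case True
    let ?S = "{i. i < n \<and> (i < a \<or> p i < b)}"
    have "d * g \<theta> \<le> (\<Sum>i\<in>?S. norm (x i - y (p i))) * g \<theta>"
      using True dist[OF p] by (intro mult_right_mono)
    also have "\<dots> = (\<Sum>i\<in>?S. norm (x i - y (p i)) * g \<theta>)"
      by (simp add: sum_distrib_right)
    also have "\<dots> \<le> (\<Sum>i\<in>?S. \<bar>proj_angle \<theta> (x i - y (p i))\<bar>)"
    proof (rule sum_mono)
      fix i assume "i \<in> ?S"
      then have "(i, p i) \<in> K" using permutes_in_image[OF p, of i] by (auto simp: K_def)
      then show "norm (x i - y (p i)) * g \<theta> \<le> \<bar>proj_angle \<theta> (x i - y (p i))\<bar>"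
        by (simp add: \<beta> abs_mult mult_left_mono g_le)
    qed
    also have "\<dots> \<le> (\<Sum>i<n. \<bar>proj_angle \<theta> (x i - y (p i))\<bar>)"
      by (intro sum_mono2) auto
    finally show ?thesis .
  next
    case False
    then have "d * g \<theta> \<le> 0" using d0 by (simp add: mult_nonneg_nonpos)
    also have "0 \<le> (\<Sum>i<n. \<bar>proj_angle \<theta> (x i - y (p i))\<bar>)" by (intro sum_nonneg) auto
    finally show ?thesis .
  qed

  have h_int: "h k integrable_on {-pi/2..pi/2}" for k
    unfolding h_def by (intro integrable_continuous_real continuous_intros)
  have g_int: "g integrable_on {-pi/2..pi/2}"
    unfolding g_def by (intro integrable_diff integrable_sum finK h_int) auto
  have "c * pi - M * (c\<^sup>2 * pi / 2) \<le> c * pi - real (card K) * (c\<^sup>2 * pi / 2)"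
    using cardK by (intro diff_left_mono mult_right_mono) auto
  also have "\<dots> = c * pi - (\<Sum>k\<in>K. c\<^sup>2 * pi / 2)"
    by simp
  also have "\<dots> \<le> c * pi - (\<Sum>k\<in>K. integral {-pi/2..pi/2} (h k))"
    unfolding h_def using c by (intro diff_left_mono sum_mono integral_truncated_sin_le) auto
  also have "\<dots> = integral {-pi/2..pi/2} g"
    unfolding g_def using h_int finK
    by (subst Henstock_Kurzweil_Integration.integral_diff)
      (auto simp: Henstock_Kurzweil_Integration.integral_sum integrable_sum)
  \<comment> \<open>As \<open>M * c = 1\<close>, the loss is exactly half of
    \<open>c * pi\<close>.\<close>
  finally have "pi / (2 * M) \<le> integral {-pi/2..pi/2} g"
    using M1 by (simp add: c_def power2_eq_square field_simps)
  then have "d * (pi / (2 * M)) \<le> d * integral {-pi/2..pi/2} g"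
    using d0 by (rule mult_left_mono)
  also have "\<dots> = integral {-pi/2..pi/2} (\<lambda>\<theta>. d * g \<theta>)"
    by simp
  also have "\<dots> \<le> integral {-pi/2..pi/2}
      (\<lambda>\<theta>. MIN p\<in>{p. p permutes {..<n}}. \<Sum>i<n. \<bar>proj_angle \<theta> (x i - y (p i))\<bar>)"
  proof (rule integral_le)
    show "(\<lambda>\<theta>. d * g \<theta>) integrable_on {-pi/2..pi/2}"
      using integrable_cmul[OF g_int, of d] by simp
    fix \<theta> :: real
    have "finite {p. p permutes {..<n}}" by (simp add: finite_permutations)
    moreover have "{p. p permutes {..<n}} \<noteq> {}" using permutes_id by blast
    ultimately show "d * g \<theta> \<le> (MIN p\<in>{p. p permutes {..<n}}. \<Sum>i<n. \<bar>proj_angle \<theta> (x i - y (p i))\<bar>)"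
      by (subst Min_ge_iff) (auto intro: cost)
  qed (rule sliced_wasserstein_indexed(1)[OF x(2) y(2)])
  also have "\<dots> = pi * sliced_wasserstein D1 D2"
    by (simp add: sliced_wasserstein_indexed(2)[OF x(2) y(2)])
  finally show ?thesis
    unfolding d_def M_def[symmetric] using M1 by (simp add: field_simps)
qed

section \<open>The kernel metric\<close>

text \<open>Convexity of \<open>exp\<close> between \<open>0\<close> and \<open>- T\<close>, at the
  point of weight \<open>x / T\<close>.\<close>

lemma one_minus_exp_ge_chord:
  assumes "0 \<le> x" "x \<le> T" "0 < (T::real)"
  shows "(1 - exp (- T)) / T * x \<le> 1 - exp (- x)"
proof -
  have "convex_on UNIV (exp :: real \<Rightarrow> real)" by (rule exp_convex)
  then have "exp ((1 - x / T) *\<^sub>R 0 + (x / T) *\<^sub>R (- T)) \<le> (1 - x / T) * exp 0 + x / T * exp (- T)"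
    using assms by (intro convex_onD) auto
  then have "exp (- x) \<le> 1 - x / T + x / T * exp (- T)"
    using assms by simp
  moreover have "(1 - exp (- T)) / T * x = x / T - x / T * exp (- T)"
    by (simp add: diff_divide_distrib algebra_simps)
  ultimately show ?thesis by linarith
qed

text \<open>The reproducing property makes \<open>\<phi> u \<bullet> \<phi> v\<close> equal to
  \<open>k u v\<close>; then the square is expanded.\<close>

lemma rkhs_metric_power2:
  assumes "is_rkhs X k fn \<phi>" "x \<in> X" "y \<in> X"
  shows "(rkhs_metric \<phi> x y)\<^sup>2 = k x x - 2 * k x y + k y y"
proof -
  have "\<phi> u \<bullet> \<phi> v = k u v" if "u \<in> X" "v \<in> X" for u v
    using assms(1) that unfolding is_rkhs_def by metis
  then show ?thesis
    using assms(2,3)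
    by (simp add: rkhs_metric_def power2_norm_eq_inner inner_diff_left inner_diff_right inner_commute)
qed

lemma kappa_pos:
  assumes "\<sigma> q > 0" "T q > 0"
  shows "kappa N \<sigma> T q > 0"
proof -
  have "0 < 1 + 2 * real N * (2 * real N - 1)"
    by (cases N) (simp_all add: add_pos_nonneg)
  then show ?thesis using assms by (simp add: kappa_def)
qed

text \<open>The factor \<open>M\<close> in the denominator of \<open>kappa\<close> cancels the
  constant of the comparison with \<open>sliced_wasserstein\<close>, leaving twice the chord slope
  times \<open>u\<close>.\<close>

lemma kappa_mult_diagram_dist_le:
  assumes "\<sigma> q > 0" "T q > 0" "size D1 \<le> N" "size D2 \<le> N"
    and "sliced_wasserstein D1 D2 / (2 * (\<sigma> q)\<^sup>2) \<le> T q"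
  shows "kappa N \<sigma> T q * diagram_dist D1 D2 \<le> 2 - 2 * exp (- sliced_wasserstein D1 D2 / (2 * (\<sigma> q)\<^sup>2))"
proof -
  define M where "M = 1 + 2 * real N * (2 * real N - 1)"
  define u where "u = sliced_wasserstein D1 D2 / (2 * (\<sigma> q)\<^sup>2)"
  have M: "0 < M" by (cases N) (simp_all add: M_def add_pos_nonneg)
  have "kappa N \<sigma> T q * diagram_dist D1 D2 \<le> kappa N \<sigma> T q * (2 * M * sliced_wasserstein D1 D2)"
    using kappa_pos[of \<sigma> q T N] assms(1,2) diagram_dist_le_sliced_wasserstein[OF assms(3,4)]
    by (intro mult_left_mono) (auto simp: M_def)
  also have "\<dots> = 2 * ((1 - exp (- T q)) / T q * u)"
    unfolding kappa_def u_def M_def[symmetric] using assms(1,2) M by (simp add: field_simps)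
  also have "\<dots> \<le> 2 * (1 - exp (- u))"
    using assms sliced_wasserstein_nonneg
    by (intro mult_left_mono one_minus_exp_ge_chord) (auto simp: u_def)
  finally show ?thesis by (simp add: u_def)
qed

theorem theorem3p5:
  fixes Q N :: nat
    and \<sigma> lam T :: "nat \<Rightarrow> real"
    and Dn Dm :: graded_diagram
    and fn :: "'h::{real_inner, complete_space} \<Rightarrow> graded_diagram \<Rightarrow> real"
    and \<phi> :: "graded_diagram \<Rightarrow> 'h"
  assumes "\<And>q. q \<le> Q \<Longrightarrow> \<sigma> q > 0"
    and "\<And>q. q \<le> Q \<Longrightarrow> lam q \<ge> 0"
    and "(\<Sum>q\<le>Q. lam q) = 1"
    and "is_rkhs (graded_diagrams Q) (combined_kernel Q \<sigma> lam) fn \<phi>"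
    and "N \<ge> 1"
    and "Dn \<in> graded_diagrams Q" and "Dm \<in> graded_diagrams Q"
    and "\<And>q. q \<le> Q \<Longrightarrow> size (Dn q) \<le> N \<and> size (Dm q) \<le> N"
    and "\<And>q. q \<le> Q \<Longrightarrow> T q > 0"
    and "\<And>q. q \<le> Q \<Longrightarrow> sliced_wasserstein (Dn q) (Dm q) / (2 * (\<sigma> q)\<^sup>2) \<le> T q"
  shows "(\<forall>q\<le>Q. kappa N \<sigma> T q > 0) \<and>
    (rkhs_metric \<phi> Dn Dm)\<^sup>2 \<ge>
      (MIN q\<in>{..Q}. kappa N \<sigma> T q) * (\<Sum>q\<le>Q. lam q * diagram_dist (Dn q) (Dm q))"
proof
  show "\<forall>q\<le>Q. kappa N \<sigma> T q > 0"
    using assms(1,9) by (simp add: kappa_pos)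
  let ?m = "MIN q\<in>{..Q}. kappa N \<sigma> T q"
  have "?m * (\<Sum>q\<le>Q. lam q * diagram_dist (Dn q) (Dm q)) =
      (\<Sum>q\<le>Q. lam q * (?m * diagram_dist (Dn q) (Dm q)))"
    by (simp add: sum_distrib_left mult_ac)
  also have "\<dots> \<le> (\<Sum>q\<le>Q. lam q * (2 - 2 * sw_kernel \<sigma> q Dn Dm))"
  proof (intro sum_mono mult_left_mono)
    fix q assume q: "q \<in> {..Q}"
    then have "?m * diagram_dist (Dn q) (Dm q) \<le> kappa N \<sigma> T q * diagram_dist (Dn q) (Dm q)"
      by (intro mult_right_mono diagram_dist_nonneg Min_le) auto
    also have "\<dots> \<le> 2 - 2 * sw_kernel \<sigma> q Dn Dm"
      unfolding sw_kernel_def using assms(1,8-10) q by (intro kappa_mult_diagram_dist_le) auto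
    finally show "?m * diagram_dist (Dn q) (Dm q) \<le> 2 - 2 * sw_kernel \<sigma> q Dn Dm" .
  qed (use assms(2) in auto)
  also have "\<dots> = 2 * (\<Sum>q\<le>Q. lam q) - 2 * combined_kernel Q \<sigma> lam Dn Dm"
    by (simp add: combined_kernel_def sum_distrib_left sum_subtractf algebra_simps)
  \<comment> \<open>Both self-kernels equal the sum of the weights, which is 1.\<close>
  also have "\<dots> = (rkhs_metric \<phi> Dn Dm)\<^sup>2"
    using assms(3) rkhs_metric_power2[OF assms(4,6,7)]
    by (simp add: combined_kernel_def sw_kernel_def sliced_wasserstein_self)
  finally show "(rkhs_metric \<phi> Dn Dm)\<^sup>2 \<ge>
      ?m * (\<Sum>q\<le>Q. lam q * diagram_dist (Dn q) (Dm q))" .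
qed

end
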